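(* There exists a regular countable topological space $X$ of weight $\omega_1$ such that: (a) $X$ is not cometrizable, and hence not stratifiable; (b) if $\omega_1=\mathfrak c$, then $X$ contains no infinite compact subsets and $X$ is $\mathsf{cs}$-cosmic; (c) if $\omega_1<\mathfrak p$, then $X$ is Fréchet-Urysohn and is not $\mathsf{cs}$-cosmic.
   Context: Regular spaces are assumed to be Hausdorff. $\mathfrak c$ is the cardinality of the continuum. The cardinal $\mathfrak p$ is defined as the smallest character of a countable topological space with a unique non-isolated point which is not Fréchet-Urysohn. A topological space $X$ is called cometrizable if it admits a weaker (i.e. contained in the original topology) metrizable topology such that each point $x\in X$ has a (not necessarily open) neighborhood base, with respect to the original topology of $X$, consisting of sets that are closed in the metrizable topology. A regular topological space $X$ is stratifiable if each point $x\in X$ has a countable system of open neighborhoods $(U_n(x))_{n\in\omega}$ such that each closed subset $F$ of $X$ is equal to $\bigcap_{n\in\omega}\overline{U_n[F]}$, where $U_n[F]=\bigcup_{x\in F}U_n(x)$. A topological space $X$ is Fréchet-Urysohn if for any subset $A\subseteq X$ and point $x\in\overline A$ there exists a sequence of points of $A$ that converges to $x$. A family $\mathcal N$ of subsets of a topological space $X$ is a $\mathsf{cs}$-network if for each open set $U\subseteq X$ and each sequence $(x_n)_{n\in\omega}$ of points of $X$ converging to a point $x\in U$ there exists $N\in\mathcal N$ such that $N\subseteq U$ and the set $\{n\in\omega:x_n\in N\}$ is infinite. A regular topological space is $\mathsf{cs}$-cosmic if it has a countable $\mathsf{cs}$-network. *)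

theory Defs
  imports "HOL-Analysis.Analysis"
begin

unbundle cardinal_syntax

text \<open>Cardinals are represented, as in the library, by cardinal orders (\<^const>\<open>Card_order\<close>)
  and compared by \<^const>\<open>ordIso\<close>, \<^const>\<open>ordLeq\<close> and \<^const>\<open>ordLess\<close>. So the cardinals defined
  below are meaningful only up to \<open>=o\<close>.\<close>

definition least_card :: "'b rel set \<Rightarrow> 'b rel" where
  "least_card C = (SOME r. r \<in> C \<and> (\<forall>r'\<in>C. r \<le>o r'))"

lemma least_card:
  assumes "C \<noteq> {}" and "\<And>r. r \<in> C \<Longrightarrow> Card_order r"
  shows "least_card C \<in> C" and "\<And>r. r \<in> C \<Longrightarrow> least_card C \<le>o r"
proof -
  have "\<exists>r. r \<in> C \<and> (\<forall>r'\<in>C. r \<le>o r')"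
    using exists_minim_Card_order[of C] assms by blast
  then have *: "least_card C \<in> C \<and> (\<forall>r'\<in>C. least_card C \<le>o r')"
    unfolding least_card_def by (rule someI_ex)
  then show "least_card C \<in> C" by blast
  show "\<And>r. r \<in> C \<Longrightarrow> least_card C \<le>o r" using * by blast
qed

definition base_of_topology :: "'a topology \<Rightarrow> 'a set set \<Rightarrow> bool" where
  "base_of_topology X \<B> \<longleftrightarrow>
     (\<forall>V\<in>\<B>. openin X V) \<and>
     (\<forall>W x. openin X W \<and> x \<in> W \<longrightarrow> (\<exists>V\<in>\<B>. x \<in> V \<and> V \<subseteq> W))"

definition weight :: "'a topology \<Rightarrow> 'a set rel" where
  "weight X = least_card {|\<B>| | \<B>. base_of_topology X \<B>}"

definition local_base :: "'a topology \<Rightarrow> 'a \<Rightarrow> 'a set set \<Rightarrow> bool" where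
  "local_base X x \<B> \<longleftrightarrow>
     (\<forall>V\<in>\<B>. openin X V \<and> x \<in> V) \<and>
     (\<forall>W. openin X W \<and> x \<in> W \<longrightarrow> (\<exists>V\<in>\<B>. V \<subseteq> W))"

definition character_at :: "'a topology \<Rightarrow> 'a \<Rightarrow> 'a set rel" where
  "character_at X x = least_card {|\<B>| | \<B>. local_base X x \<B>}"

text \<open>The character of a space is the supremum of its characters at points.\<close>

definition character :: "'a topology \<Rightarrow> 'a set rel" where
  "character X =
     least_card {r. Card_order r \<and> (\<forall>x\<in>topspace X. character_at X x \<le>o r)}"

definition Frechet_Urysohn :: "'a topology \<Rightarrow> bool" where
  "Frechet_Urysohn X \<longleftrightarrow>
     (\<forall>A x. A \<subseteq> topspace X \<and> x \<in> X closure_of A \<longrightarrow>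
        (\<exists>s::nat \<Rightarrow> 'a. range s \<subseteq> A \<and> limitin X s x sequentially))"

text \<open>Every countable space is homeomorphic to one whose points are natural numbers,
  so it suffices to let \<open>X\<close> range over topologies on subsets of \<^typ>\<open>nat\<close>.\<close>

definition cardinal_p :: "nat set rel" where
  "cardinal_p = least_card {character X | X :: nat topology.
     countable (topspace X) \<and>
     (\<exists>!x. x \<in> topspace X \<and> \<not> openin X {x}) \<and> \<not> Frechet_Urysohn X}"

definition omega1 :: "nat set rel" where
  "omega1 = cardSuc natLeq"

definition continuum :: "real rel" where
  "continuum = |UNIV :: real set|"

definition regular_Hausdorff :: "'a topology \<Rightarrow> bool" where
  "regular_Hausdorff X \<longleftrightarrow> regular_space X \<and> Hausdorff_space X"

definition cometrizable :: "'a topology \<Rightarrow> bool" where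
  "cometrizable X \<longleftrightarrow>
     (\<exists>Y. topspace Y = topspace X \<and> (\<forall>U. openin Y U \<longrightarrow> openin X U) \<and>
          metrizable_space Y \<and> neighbourhood_base_of (closedin Y) X)"

definition stratifiable :: "'a topology \<Rightarrow> bool" where
  "stratifiable X \<longleftrightarrow> regular_Hausdorff X \<and>
     (\<exists>U :: nat \<Rightarrow> 'a \<Rightarrow> 'a set.
        (\<forall>x\<in>topspace X. \<forall>n. openin X (U n x) \<and> x \<in> U n x) \<and>
        (\<forall>F. closedin X F \<longrightarrow> F = (\<Inter>n. X closure_of (\<Union>x\<in>F. U n x))))"

definition cs_network :: "'a topology \<Rightarrow> 'a set set \<Rightarrow> bool" where
  "cs_network X \<N> \<longleftrightarrow>
     (\<forall>N\<in>\<N>. N \<subseteq> topspace X) \<and>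
     (\<forall>U s x. openin X U \<and> range s \<subseteq> topspace X \<and> limitin X s x sequentially \<and> x \<in> U \<longrightarrow>
        (\<exists>N\<in>\<N>. N \<subseteq> U \<and> infinite {n::nat. s n \<in> N}))"

definition cs_cosmic :: "'a topology \<Rightarrow> bool" where
  "cs_cosmic X \<longleftrightarrow> regular_Hausdorff X \<and> (\<exists>\<N>. countable \<N> \<and> cs_network X \<N>)"

end

theory Submission
  imports Defs "HOL-Algebra.Free_Abelian_Groups" "HOL-Library.Countable_Set_Type"
begin

text \<open>
  The space is a countable dense subspace of the Cantor cube \<open>2\<^sup>\<omega>\<^sup>1\<close>: the points are the natural
  numbers, and the topology is generated by sets \<open>U i\<close>, \<open>i \<in> I\<close>, and their complements, where
  \<open>I\<close> has cardinality \<open>\<omega>\<^sub>1\<close>. Density means that the family is independent: all finite Boolean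
  combinations of distinct \<open>U i\<close> and complements are nonempty.

  The proof rests on a reflection argument. Since the space is countable, countably many open sets
  involve only countably many indices, so they are open already in the second countable topology
  \<open>\<tau>\<^sub>J\<close> generated by the \<open>U j\<close> with \<open>j\<close> in some countable \<open>J \<subseteq> I\<close> (lemma \<open>reflection\<close>). Choose
  \<open>i \<in> I\<close> outside \<open>J\<close>. By independence \<open>U i\<close> and its complement are both \<open>\<tau>\<^sub>J\<close>-dense,
  and the \<open>\<tau>\<^sub>J\<close>-closure of a nonempty open set contains a nonempty \<open>\<tau>\<^sub>J\<close>-open set. So no nonempty open
  set lies in a \<open>\<tau>\<^sub>J\<close>-closed subset of \<open>U i\<close> (lemma \<open>closedin_subset_member_nowhere_dense\<close>). A weaker
  metrizable topology has a countable base, hence is contained in some \<open>\<tau>\<^sub>J\<close>, and then the points of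
  \<open>U i\<close> have no neighbourhood that is closed in it and contained in \<open>U i\<close>; this refutes
  cometrizability. Stratifications and countable bases are countable families of open sets too, and
  they are excluded in the same way.

  If \<open>\<omega>\<^sub>1 < \<pp>\<close>, then every filter base of size at most \<open>\<omega>\<^sub>1\<close> on the natural numbers has a sequence that
  is eventually in each of its members. Hence for sets \<open>A k\<close> that decrease with \<open>k\<close> and all have \<open>x\<close>
  in their closure, some sequence converges to \<open>x\<close> and is eventually in each \<open>A k\<close>. Constant
  sequences of sets give the Frechet-Urysohn property. For a countable cs-network, reflect the
  complements of the closures of its members: the members inside \<open>U i\<close> then have nowhere dense
  closures, and removing the finite unions of these from \<open>U i\<close> yields sets \<open>A k\<close> for which the
  sequence obtained avoids, up to finitely many terms, every network member inside \<open>U i\<close>.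

  The family is built by recursion along \<open>\<omega>\<^sub>1\<close>. At each stage only countably many infinite sets must be
  split into two infinite parts, and this preserves independence. If \<open>\<omega>\<^sub>1 = \<cc>\<close>, the stages
  can be arranged so that each infinite set is split by some \<open>U i\<close>. Then no convergent
  sequence has infinitely many values, so that the singletons form a cs-network, and
  an infinite compact set, in which there would be such a sequence, cannot exist.
\<close>

section \<open>Topologies generated by a family of clopen sets\<close>

text \<open>The finite Boolean combination that prescribes membership in \<open>U i\<close> for \<open>i \<in> F\<close>: the
  trace on the space of a basic open subset of the Cantor cube.\<close>

definition atom :: "('i \<Rightarrow> 'a set) \<Rightarrow> 'i set \<Rightarrow> 'i set \<Rightarrow> 'a set" where
  "atom U F P = {y. \<forall>i\<in>F. y \<in> U i \<longleftrightarrow> i \<in> P}"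

text \<open>The atom over \<open>F\<close> that contains the point \<open>x\<close>.\<close>

definition cell :: "('i \<Rightarrow> 'a set) \<Rightarrow> 'i set \<Rightarrow> 'a \<Rightarrow> 'a set" where
  "cell U F x = {y. \<forall>i\<in>F. y \<in> U i \<longleftrightarrow> x \<in> U i}"

definition cell_topology :: "('i \<Rightarrow> 'a set) \<Rightarrow> 'i set \<Rightarrow> 'a topology" where
  "cell_topology U J =
     topology (\<lambda>W. \<forall>x\<in>W. \<exists>F. finite F \<and> F \<subseteq> J \<and> cell U F x \<subseteq> W)"

lemma cell_self [simp]: "x \<in> cell U F x"
  by (simp add: cell_def)

lemma cell_eq: "y \<in> cell U F x \<Longrightarrow> cell U F y = cell U F x"
  by (auto simp: cell_def)

lemma cell_Un: "cell U (F \<union> G) x = cell U F x \<inter> cell U G x"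
  by (auto simp: cell_def)

lemma openin_cell_topology:
  "openin (cell_topology U J) W \<longleftrightarrow> (\<forall>x\<in>W. \<exists>F. finite F \<and> F \<subseteq> J \<and> cell U F x \<subseteq> W)"
proof -
  have "istopology (\<lambda>W. \<forall>x\<in>W. \<exists>F. finite F \<and> F \<subseteq> J \<and> cell U F x \<subseteq> W)"
    unfolding istopology_def
  proof (intro conjI allI impI ballI)
    fix S T x
    assume S: "\<forall>x\<in>S. \<exists>F. finite F \<and> F \<subseteq> J \<and> cell U F x \<subseteq> S"
      and T: "\<forall>x\<in>T. \<exists>F. finite F \<and> F \<subseteq> J \<and> cell U F x \<subseteq> T" and x: "x \<in> S \<inter> T"
    obtain F where "finite F" "F \<subseteq> J" "cell U F x \<subseteq> S" using S x by blast
    moreover obtain G where "finite G" "G \<subseteq> J" "cell U G x \<subseteq> T" using T x by blast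
    ultimately show "\<exists>F. finite F \<and> F \<subseteq> J \<and> cell U F x \<subseteq> S \<inter> T"
      by (intro exI[of _ "F \<union> G"]) (auto simp: cell_Un)
  next
    fix \<K> x
    assume K: "\<forall>W\<in>\<K>. \<forall>x\<in>W. \<exists>F. finite F \<and> F \<subseteq> J \<and> cell U F x \<subseteq> W" and "x \<in> \<Union>\<K>"
    then show "\<exists>F. finite F \<and> F \<subseteq> J \<and> cell U F x \<subseteq> \<Union>\<K>"
      by (meson UnionE Union_upper subset_trans)
  qed
  then show ?thesis
    unfolding cell_topology_def by (simp add: topology_inverse')
qed

lemma topspace_cell_topology [simp]: "topspace (cell_topology U J) = UNIV"
proof -
  have "openin (cell_topology U J) UNIV"
    unfolding openin_cell_topology by auto
  then show ?thesis
    using openin_subset by blast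
qed

lemma openin_cell_topologyE:
  assumes "openin (cell_topology U J) W" "x \<in> W"
  obtains F where "finite F" "F \<subseteq> J" "cell U F x \<subseteq> W"
  using assms by (auto simp: openin_cell_topology)

lemma openin_cell: "finite F \<Longrightarrow> F \<subseteq> J \<Longrightarrow> openin (cell_topology U J) (cell U F x)"
  unfolding openin_cell_topology using cell_eq by fastforce

lemma closedin_cell:
  assumes "finite F" "F \<subseteq> J" shows "closedin (cell_topology U J) (cell U F x)"
proof -
  have "cell U F y \<subseteq> - cell U F x" if "y \<in> - cell U F x" for y
    using that by (auto simp: cell_def)
  then have "openin (cell_topology U J) (- cell U F x)"
    unfolding openin_cell_topology using assms by blast
  then show ?thesis by (simp add: closedin_def Compl_eq_Diff_UNIV)
qed

lemma openin_member: "i \<in> J \<Longrightarrow> openin (cell_topology U J) (U i)"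
  unfolding openin_cell_topology
  by (intro ballI exI[of _ "{i}"]) (auto simp: cell_def)

lemma closedin_member: "i \<in> J \<Longrightarrow> closedin (cell_topology U J) (U i)"
proof -
  assume "i \<in> J"
  then have "openin (cell_topology U J) (- U i)"
    unfolding openin_cell_topology
    by (intro ballI exI[of _ "{i}"]) (auto simp: cell_def)
  then show ?thesis by (simp add: closedin_def Compl_eq_Diff_UNIV)
qed

lemma regular_cell_topology: "regular_space (cell_topology U J)"
  unfolding neighbourhood_base_of_closedin[symmetric] neighbourhood_base_of
  by (metis cell_self closedin_cell openin_cell openin_cell_topologyE subset_refl)

lemma limitin_cell_topology:
  "limitin (cell_topology U J) s x sequentially \<longleftrightarrow>
     (\<forall>i\<in>J. \<forall>\<^sub>F n in sequentially. s n \<in> U i \<longleftrightarrow> x \<in> U i)" (is "?L \<longleftrightarrow> ?R")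
proof
  assume L: ?L
  show ?R
  proof
    fix i assume "i \<in> J"
    then have "\<forall>\<^sub>F n in sequentially. s n \<in> cell U {i} x"
      using L by (simp add: limitin_def openin_cell)
    then show "\<forall>\<^sub>F n in sequentially. s n \<in> U i \<longleftrightarrow> x \<in> U i"
      by eventually_elim (simp add: cell_def)
  qed
next
  assume R: ?R
  show ?L
    unfolding limitin_def
  proof (intro conjI allI impI)
    fix W assume W: "openin (cell_topology U J) W \<and> x \<in> W"
    then obtain F where F: "finite F" "F \<subseteq> J" "cell U F x \<subseteq> W"
      using openin_cell_topologyE by metis
    have "\<forall>\<^sub>F n in sequentially. \<forall>i\<in>F. s n \<in> U i \<longleftrightarrow> x \<in> U i"
      using R F by (intro eventually_ball_finite) auto
    then show "\<forall>\<^sub>F n in sequentially. s n \<in> W"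
      by eventually_elim (use F in \<open>auto simp: cell_def\<close>)
  qed simp
qed

lemma metrizable_countable_imp_second_countable:
  assumes "metrizable_space Y" and "countable (topspace Y)"
  obtains \<V> where "countable \<V>" "base_of_topology Y \<V>"
proof -
  obtain M d where Md: "Metric_space M d" and Y: "Y = Metric_space.mtopology M d"
    using assms(1) unfolding metrizable_space_def by blast
  interpret Metric_space M d by fact
  define \<V> where "\<V> = (\<lambda>(x, n). mball x (inverse (real (Suc n)))) ` (M \<times> UNIV)"
  have "countable \<V>"
    using assms(2) unfolding \<V>_def Y by simp
  moreover have "base_of_topology Y \<V>"
    unfolding base_of_topology_def
  proof (intro conjI allI impI ballI)
    show "openin Y V" if "V \<in> \<V>" for V
      using that unfolding \<V>_def Y by auto
  next
    fix W x assume Wx: "openin Y W \<and> x \<in> W"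
    then obtain r where "x \<in> M" "r > 0" "mball x r \<subseteq> W"
      unfolding Y openin_mtopology by blast
    moreover obtain n where "inverse (real (Suc n)) < r"
      using reals_Archimedean \<open>r > 0\<close> by blast
    ultimately show "\<exists>V\<in>\<V>. x \<in> V \<and> V \<subseteq> W"
      unfolding \<V>_def
      by (intro bexI[of _ "mball x (inverse (real (Suc n)))"])
         (auto intro: mball_subset_concentric[THEN subsetD] order.trans)
  qed
  ultimately show ?thesis using that by blast
qed

section \<open>Uncountable independent families on the natural numbers\<close>

locale independent_family =
  fixes I :: "'i set" and U :: "'i \<Rightarrow> nat set"
  assumes independent: "finite F \<Longrightarrow> F \<subseteq> I \<Longrightarrow> atom U F P \<noteq> {}"
    and separating: "x \<noteq> y \<Longrightarrow> \<exists>i\<in>I. \<not> (x \<in> U i \<longleftrightarrow> y \<in> U i)"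
    and uncountable_index: "uncountable I"
begin

abbreviation X :: "nat topology" where
  "X \<equiv> cell_topology U I"

lemma regular_Hausdorff: "regular_Hausdorff X"
proof -
  have "Hausdorff_space X"
    unfolding Hausdorff_space_def
  proof (intro allI impI)
    fix x y assume "x \<in> topspace X \<and> y \<in> topspace X \<and> x \<noteq> y"
    then obtain i where i: "i \<in> I" "\<not> (x \<in> U i \<longleftrightarrow> y \<in> U i)"
      using separating by blast
    then show "\<exists>V W. openin X V \<and> openin X W \<and> x \<in> V \<and> y \<in> W \<and> disjnt V W"
      by (intro exI[of _ "cell U {i} x"] exI[of _ "cell U {i} y"])
         (auto simp: openin_cell, auto simp: disjnt_def cell_def)
  qed
  then show ?thesis
    by (simp add: regular_Hausdorff_def regular_cell_topology)
qed

text \<open>Countably many open sets have countably many points altogether, and at each of them a finite set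
  of indices witnesses openness. All these indices form the countable set \<open>J\<close>; the index \<open>i\<close>
  outside of it exists because the family is uncountable.\<close>

lemma reflection:
  assumes "countable \<V>" and op: "\<And>V. V \<in> \<V> \<Longrightarrow> openin X V"
  obtains J i where "J \<subseteq> I" "i \<in> I" "i \<notin> J"
    "\<And>V. V \<in> \<V> \<Longrightarrow> openin (cell_topology U J) V"
proof -
  have "\<forall>V\<in>\<V>. \<forall>x\<in>V. \<exists>F. finite F \<and> F \<subseteq> I \<and> cell U F x \<subseteq> V"
    using op unfolding openin_cell_topology by blast
  then obtain F where F: "\<And>V x. V \<in> \<V> \<Longrightarrow> x \<in> V \<Longrightarrow> finite (F V x) \<and> F V x \<subseteq> I \<and> cell U (F V x) x \<subseteq> V"
    by metis
  define J where "J = (\<Union>V\<in>\<V>. \<Union>x\<in>V. F V x)"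
  have "countable J"
    unfolding J_def using assms(1) F by (intro countable_UN) (auto intro: countable_finite)
  then obtain i where "i \<in> I" "i \<notin> J"
    using uncountable_index by (meson countable_subset subsetI)
  moreover have "J \<subseteq> I"
    unfolding J_def using F by blast
  moreover have "openin (cell_topology U J) V" if "V \<in> \<V>" for V
    unfolding openin_cell_topology
  proof
    fix x assume x: "x \<in> V"
    then have "F V x \<subseteq> J"
      unfolding J_def using that by blast
    then show "\<exists>F. finite F \<and> F \<subseteq> J \<and> cell U F x \<subseteq> V"
      using F[OF that x] by blast
  qed
  ultimately show ?thesis using that by blast
qed

lemma cells_meet:
  assumes "finite F" "F \<subseteq> I" "finite H" "H \<subseteq> I" "F \<inter> H = {}"
  obtains y where "y \<in> cell U F x" "y \<in> cell U H z"
proof -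
  have "atom U (F \<union> H) ({i\<in>F. x \<in> U i} \<union> {i\<in>H. z \<in> U i}) \<noteq> {}"
    using assms by (intro independent) auto
  then obtain y where "y \<in> atom U (F \<union> H) ({i\<in>F. x \<in> U i} \<union> {i\<in>H. z \<in> U i})"
    by blast
  then have "y \<in> cell U F x" "y \<in> cell U H z"
    using assms(5) by (auto simp: atom_def cell_def)
  then show ?thesis using that by blast
qed

lemma member_cell_meet:
  assumes "finite F" "F \<subseteq> I" "i \<in> I" "i \<notin> F"
  shows "cell U F x \<inter> U i \<noteq> {}" and "\<not> cell U F x \<subseteq> U i"
proof -
  obtain z where "z \<in> U i"
    using independent[of "{i}" "{i}"] assms by (auto simp: atom_def)
  then obtain y where "y \<in> cell U F x" "y \<in> U i"
    using cells_meet[of F "{i}" x z] assms by (auto simp: cell_def)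
  then show "cell U F x \<inter> U i \<noteq> {}" by blast
  obtain z where "z \<notin> U i"
    using independent[of "{i}" "{}"] assms by (auto simp: atom_def)
  then obtain y where "y \<in> cell U F x" "y \<notin> U i"
    using cells_meet[of F "{i}" x z] assms by (auto simp: cell_def)
  then show "\<not> cell U F x \<subseteq> U i" by blast
qed

text \<open>A basic neighbourhood contained in \<open>W\<close> imposes conditions with indices in \<open>J\<close> and
  conditions with other indices. By independence the latter define a set that meets every nonempty
  set open in the topology of \<open>J\<close>, so that only the former survive in the closure.\<close>

lemma closure_contains_cell:
  assumes "J \<subseteq> I" "openin X W" "x \<in> W"
  obtains F where "finite F" "F \<subseteq> J" "cell U F x \<subseteq> cell_topology U J closure_of W"
proof -
  obtain G where G: "finite G" "G \<subseteq> I" "cell U G x \<subseteq> W"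
    using openin_cell_topologyE assms(2,3) .
  have "y \<in> cell_topology U J closure_of W" if y: "y \<in> cell U (G \<inter> J) x" for y
    unfolding in_closure_of
  proof (intro conjI allI impI)
    fix T assume "y \<in> T \<and> openin (cell_topology U J) T"
    then obtain H where H: "finite H" "H \<subseteq> J" "cell U H y \<subseteq> T"
      using openin_cell_topologyE by metis
    obtain w where w: "w \<in> cell U (H \<union> (G \<inter> J)) y" "w \<in> cell U (G - J) x"
      using cells_meet[of "H \<union> (G \<inter> J)" "G - J" y x] G H assms(1) by blast
    have "w \<in> cell U G x"
      using w y by (auto simp: cell_def)
    moreover have "w \<in> T"
      using w H by (auto simp: cell_Un)
    ultimately show "\<exists>y. y \<in> W \<and> y \<in> T" using G by blast
  qed simp
  then show ?thesis
    using that[of "G \<inter> J"] G by blast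
qed

text \<open>The closure of \<open>W\<close> in the topology of \<open>J\<close> would contain a cell over \<open>J\<close>, but such a cell
  meets the complement of \<open>U i\<close>.\<close>

lemma closedin_subset_member_nowhere_dense:
  assumes "J \<subseteq> I" "i \<in> I" "i \<notin> J" "closedin (cell_topology U J) C" "C \<subseteq> U i"
    and "openin X W" "W \<subseteq> C"
  shows "W = {}"
proof (rule ccontr)
  assume "W \<noteq> {}"
  then obtain x where "x \<in> W" by blast
  then obtain F where F: "finite F" "F \<subseteq> J" "cell U F x \<subseteq> cell_topology U J closure_of W"
    using closure_contains_cell assms by metis
  have "cell_topology U J closure_of W \<subseteq> C"
    using assms by (simp add: closure_of_minimal)
  with F have "cell U F x \<subseteq> U i" using assms by blast
  then show False
    using member_cell_meet(2)[of F i x] F assms by blast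
qed

lemma not_cometrizable: "\<not> cometrizable X"
proof
  assume "cometrizable X"
  then obtain Y where Y: "topspace Y = UNIV" "\<And>V. openin Y V \<Longrightarrow> openin X V"
    "metrizable_space Y" "neighbourhood_base_of (closedin Y) X"
    unfolding cometrizable_def by auto
  obtain \<V> where \<V>: "countable \<V>" "base_of_topology Y \<V>"
    using metrizable_countable_imp_second_countable Y(1,3) by (metis countableI_type)
  obtain J i where J: "J \<subseteq> I" "i \<in> I" "i \<notin> J"
    and op: "\<And>V. V \<in> \<V> \<Longrightarrow> openin (cell_topology U J) V"
    using reflection[OF \<V>(1)] \<V>(2) Y(2) unfolding base_of_topology_def by metis
  have opJ: "openin (cell_topology U J) W" if "openin Y W" for W
  proof (subst openin_subopen, intro ballI)
    fix x assume "x \<in> W"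
    then show "\<exists>T. openin (cell_topology U J) T \<and> x \<in> T \<and> T \<subseteq> W"
      using \<V>(2) that op unfolding base_of_topology_def by metis
  qed
  obtain x where "x \<in> U i"
    using member_cell_meet(1)[of "{}" i] J by blast
  then obtain W C where W: "openin X W" "closedin Y C" "x \<in> W" "W \<subseteq> C" "C \<subseteq> U i"
    using Y(4) openin_member[of i I U] J unfolding neighbourhood_base_of by meson
  have "closedin (cell_topology U J) C"
    using W(2) opJ Y(1) by (simp add: closedin_def)
  then have "W = {}"
    using closedin_subset_member_nowhere_dense J W by blast
  with W show False by blast
qed

text \<open>Apply the definition of stratifiability to the closed set \<open>U i\<close>, where \<open>i\<close> lies outside the set
  \<open>J\<close> over which all the neighbourhoods of the stratification are open. Each of the unions over
  \<open>U i\<close> is open over \<open>J\<close> and contains the set \<open>U i\<close>, which is dense over \<open>J\<close>. It is then dense in \<open>X\<close>,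
  so the intersection of the closures is the whole space instead of \<open>U i\<close>.\<close>

lemma not_stratifiable: "\<not> stratifiable X"
proof
  assume "stratifiable X"
  then obtain G :: "nat \<Rightarrow> nat \<Rightarrow> nat set" where
    G: "\<And>x n. openin X (G n x) \<and> x \<in> G n x"
    and cl: "\<And>C. closedin X C \<Longrightarrow> C = (\<Inter>n. X closure_of (\<Union>x\<in>C. G n x))"
    unfolding stratifiable_def by auto
  have "countable (range (\<lambda>(n, x). G n x))" by simp
  then obtain J i where J: "J \<subseteq> I" "i \<in> I" "i \<notin> J"
    and op: "\<And>V. V \<in> range (\<lambda>(n, x). G n x) \<Longrightarrow> openin (cell_topology U J) V"
    by (rule reflection) (use G in auto)
  have "z \<in> X closure_of (\<Union>x\<in>U i. G n x)" for z n
    unfolding in_closure_of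
  proof (intro conjI allI impI)
    fix W assume W: "z \<in> W \<and> openin X W"
    obtain F where F: "finite F" "F \<subseteq> J" "cell U F z \<subseteq> cell_topology U J closure_of W"
      using closure_contains_cell J W by metis
    obtain y where y: "y \<in> cell U F z" "y \<in> U i"
      using member_cell_meet(1)[of F i z] F J by blast
    moreover have "openin (cell_topology U J) (G n y)"
      by (rule op) force
    ultimately have "\<exists>w. w \<in> W \<and> w \<in> G n y"
      using F(3) G[of n y] unfolding closure_of_def by auto
    then show "\<exists>y. y \<in> (\<Union>x\<in>U i. G n x) \<and> y \<in> W"
      using y by blast
  qed simp
  then have "U i = UNIV"
    using cl[OF closedin_member[of i I U]] J by auto
  then show False
    using member_cell_meet(2)[of "{}" i] J by blast
qed

lemma base_uncountable:
  assumes "base_of_topology X \<B>"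
  shows "uncountable \<B>"
proof
  have opB: "\<And>V. V \<in> \<B> \<Longrightarrow> openin X V"
    and baseB: "\<And>W x. openin X W \<Longrightarrow> x \<in> W \<Longrightarrow> \<exists>V\<in>\<B>. x \<in> V \<and> V \<subseteq> W"
    using assms unfolding base_of_topology_def by simp_all
  assume "countable \<B>"
  then obtain J i where J: "J \<subseteq> I" "i \<in> I" "i \<notin> J"
    and op: "\<And>V. V \<in> \<B> \<Longrightarrow> openin (cell_topology U J) V"
    using reflection opB by blast
  obtain x where "x \<in> U i"
    using member_cell_meet(1)[of "{}" i] J by blast
  then obtain V where V: "V \<in> \<B>" "x \<in> V" "V \<subseteq> U i"
    using baseB[OF openin_member[of i I U]] J by blast
  then obtain F where "finite F" "F \<subseteq> J" "cell U F x \<subseteq> V"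
    using openin_cell_topologyE op by metis
  then show False
    using member_cell_meet(2)[of F i x] J V by blast
qed

lemma limit_of_constant_subsequence:
  assumes "limitin X s x sequentially" "infinite {n. s n = y}"
  shows "y = x"
proof (rule ccontr)
  assume "y \<noteq> x"
  then obtain i where i: "i \<in> I" "\<not> (y \<in> U i \<longleftrightarrow> x \<in> U i)"
    using separating by blast
  then have "\<forall>\<^sub>F n in sequentially. s n \<in> U i \<longleftrightarrow> x \<in> U i"
    using assms(1) unfolding limitin_cell_topology by blast
  then have "\<forall>\<^sub>F n in sequentially. s n \<noteq> y"
    by eventually_elim (use i in auto)
  then show False
    using assms(2) by (simp add: eventually_cofinite flip: cofinite_eq_sequentially)
qed

end

section \<open>Cardinals\<close>

lemma Card_order_omega1: "Card_order omega1"
  unfolding omega1_def by (simp add: cardSuc_Card_order natLeq_Card_order)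

lemma omega1_ordLeq_iff: "omega1 \<le>o |A| \<longleftrightarrow> uncountable A"
proof -
  have "omega1 \<le>o |A| \<longleftrightarrow> natLeq <o |A|"
    unfolding omega1_def
    using cardSuc_ordLess_ordLeq[OF natLeq_Card_order card_of_Card_order] by blast
  also have "\<dots> \<longleftrightarrow> uncountable A"
    by (simp add: countable_card_le_natLeq natLeq_Well_order flip: not_ordLeq_iff_ordLess)
  finally show ?thesis .
qed

lemma Field_omega1: "|Field omega1| =o omega1" "uncountable (Field omega1)"
proof -
  show *: "|Field omega1| =o omega1"
    by (simp add: Card_order_omega1 card_of_Field_ordIso)
  then show "uncountable (Field omega1)"
    using omega1_ordLeq_iff ordIso_iff_ordLeq by blast
qed

lemma countable_underS_omega1: "countable (underS omega1 i)"
proof (cases "i \<in> Field omega1")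
  case True
  then have "|underS omega1 i| <o omega1"
    by (rule card_of_underS[OF Card_order_omega1])
  then show ?thesis
    unfolding omega1_def countable_card_le_natLeq
    by (rule iffD1[OF cardSuc_ordLeq_ordLess[OF natLeq_Card_order card_of_Card_order]])
next
  case False
  then have "underS omega1 i = {}"
    by (auto simp: underS_def Field_def)
  then show ?thesis by simp
qed

lemma countable_ordLeq_omega1: "countable A \<Longrightarrow> |A| \<le>o omega1"
  unfolding countable_card_le_natLeq omega1_def
  by (erule ordLeq_transitive) (rule cardSuc_ordLeq[OF natLeq_Card_order])

lemma card_of_Fpow_Times_ordLeq_omega1:
  assumes "|I| =o omega1" "countable B"
  shows "|Fpow I \<times> B| \<le>o omega1"
proof -
  have unc: "uncountable I"
    using assms(1) omega1_ordLeq_iff ordIso_iff_ordLeq by blast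
  then have inf: "infinite I" using countable_finite by blast
  have "|Fpow I| \<le>o |I|"
    using card_of_Fpow_infinite[OF inf] ordIso_iff_ordLeq by blast
  moreover have "|B| \<le>o |I|"
    using countable_ordLeq_omega1[OF assms(2)] assms(1)
    by (meson ordIso_symmetric ordLeq_ordIso_trans)
  ultimately have "|Fpow I \<times> B| \<le>o |I|"
    using inf by (simp add: card_of_Times_ordLeq_infinite)
  then show ?thesis
    using assms(1) ordLeq_ordIso_trans by blast
qed

lemma (in independent_family) weight_X:
  assumes "|I| =o omega1"
  shows "weight X =o omega1"
proof -
  define \<B> where "\<B> = (\<lambda>(F, x). cell U F x) ` (Fpow I \<times> (UNIV :: nat set))"
  have "|\<B>| \<le>o omega1"
    unfolding \<B>_def
    by (intro ordLeq_transitive[OF card_of_image] card_of_Fpow_Times_ordLeq_omega1 assms) simp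
  have "base_of_topology X \<B>"
    unfolding base_of_topology_def
  proof (intro conjI ballI allI impI)
    fix V assume "V \<in> \<B>"
    then show "openin X V"
      by (auto simp: \<B>_def Fpow_def openin_cell)
  next
    fix W x assume "openin X W \<and> x \<in> W"
    then obtain F where "finite F" "F \<subseteq> I" "cell U F x \<subseteq> W"
      using openin_cell_topologyE by metis
    then show "\<exists>V\<in>\<B>. x \<in> V \<and> V \<subseteq> W"
      by (intro bexI[of _ "cell U F x"]) (auto simp: \<B>_def Fpow_def)
  qed
  let ?C = "{|\<B>| | \<B>. base_of_topology X \<B>}"
  have C: "|\<B>| \<in> ?C" "\<And>r. r \<in> ?C \<Longrightarrow> Card_order r"
    using \<open>base_of_topology X \<B>\<close> by auto
  then have "weight X \<in> ?C"
    unfolding weight_def using least_card(1)[of ?C] by blast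
  then obtain \<B>' where "weight X = |\<B>'|" "base_of_topology X \<B>'" by blast
  then have "omega1 \<le>o weight X"
    using omega1_ordLeq_iff[of \<B>'] base_uncountable by simp
  moreover have "weight X \<le>o |\<B>|"
    unfolding weight_def using least_card(2)[of ?C] C by blast
  ultimately show ?thesis
    using ordLeq_transitive[OF _ \<open>|\<B>| \<le>o omega1\<close>] by (simp add: ordIso_iff_ordLeq)
qed

section \<open>Consequences of \<open>\<omega>\<^sub>1 < \<pp>\<close>\<close>

lemma character_at_ordLeq: "local_base X x \<B> \<Longrightarrow> character_at X x \<le>o |\<B>|"
  unfolding character_at_def by (rule least_card(2)) auto

lemma Card_order_character: "Card_order (character (X :: 'a topology))"
proof -
  let ?C = "{r. Card_order r \<and> (\<forall>x\<in>topspace X. character_at X x \<le>o r)}"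
  have "|UNIV :: 'a set set| \<in> ?C"
  proof (intro CollectI conjI ballI card_of_Card_order)
    fix x assume "x \<in> topspace X"
    have "local_base X x {W. openin X W \<and> x \<in> W}"
      by (auto simp: local_base_def)
    then show "character_at X x \<le>o |UNIV :: 'a set set|"
      by (rule ordLeq_transitive[OF character_at_ordLeq card_of_UNIV])
  qed
  then have "character X \<in> ?C"
    unfolding character_def using least_card(1)[of ?C] by blast
  then show ?thesis by blast
qed

lemma character_ordLeq:
  fixes X :: "'a topology" and r :: "'a set rel"
  assumes "Card_order r" "\<And>x. x \<in> topspace X \<Longrightarrow> character_at X x \<le>o r"
  shows "character X \<le>o r"
  unfolding character_def by (rule least_card(2)) (use assms in auto)

lemma Frechet_Urysohn_if_small_character:
  fixes X :: "nat topology"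
  assumes "omega1 <o cardinal_p" "character X \<le>o omega1"
    and "\<exists>!x. x \<in> topspace X \<and> \<not> openin X {x}"
  shows "Frechet_Urysohn X"
proof (rule ccontr)
  assume "\<not> Frechet_Urysohn X"
  then have "cardinal_p \<le>o character X"
    unfolding cardinal_p_def using assms(3)
    by (intro least_card(2)) (auto simp: Card_order_character)
  then show False
    using assms(1) not_ordLess_ordLeq ordLeq_transitive[OF _ assms(2)] by blast
qed

text \<open>Adjoin to the discrete natural numbers a point at infinity whose neighbourhoods are given by the
  filter base. The result has one non-isolated point and character at most \<open>\<omega>\<^sub>1\<close>, so it is
  Frechet-Urysohn by the minimality of \<open>\<pp>\<close>, and a sequence of isolated points converges to the point at
  infinity.\<close>

lemma sequence_along_filter_base:
  fixes \<B> :: "nat set set"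
  assumes p: "omega1 <o cardinal_p" and card: "|\<B>| \<le>o omega1"
    and "\<B> \<noteq> {}" "{} \<notin> \<B>" and dir: "\<And>A B. A \<in> \<B> \<Longrightarrow> B \<in> \<B> \<Longrightarrow> \<exists>C\<in>\<B>. C \<subseteq> A \<inter> B"
  obtains s :: "nat \<Rightarrow> nat" where "\<And>B. B \<in> \<B> \<Longrightarrow> \<forall>\<^sub>F n in sequentially. s n \<in> B"
proof -
  \<comment> \<open>The point at infinity is \<open>0\<close>; the natural number \<open>n\<close> is represented by \<open>Suc n\<close>.\<close>
  define Z where "Z = topology (\<lambda>W. 0 \<in> W \<longrightarrow> (\<exists>B\<in>\<B>. Suc ` B \<subseteq> W))"
  have "istopology (\<lambda>W. 0 \<in> W \<longrightarrow> (\<exists>B\<in>\<B>. Suc ` B \<subseteq> W))"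
    unfolding istopology_def
  proof (intro conjI allI impI)
    fix S T
    assume "0 \<in> S \<longrightarrow> (\<exists>B\<in>\<B>. Suc ` B \<subseteq> S)" "0 \<in> T \<longrightarrow> (\<exists>B\<in>\<B>. Suc ` B \<subseteq> T)" "0 \<in> S \<inter> T"
    then obtain A B where AB: "A \<in> \<B>" "B \<in> \<B>" "Suc ` A \<subseteq> S" "Suc ` B \<subseteq> T" by auto
    obtain C where "C \<in> \<B>" "C \<subseteq> A \<inter> B"
      using dir[OF AB(1,2)] by blast
    then show "\<exists>B\<in>\<B>. Suc ` B \<subseteq> S \<inter> T"
      using AB(3,4) by (intro bexI[of _ C]) (auto simp: image_subset_iff)
  next
    fix \<K> :: "nat set set"
    assume "\<forall>W\<in>\<K>. 0 \<in> W \<longrightarrow> (\<exists>B\<in>\<B>. Suc ` B \<subseteq> W)" "0 \<in> \<Union>\<K>"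
    then show "\<exists>B\<in>\<B>. Suc ` B \<subseteq> \<Union>\<K>"
      by (metis UnionE Union_upper subset_trans)
  qed
  then have Z: "openin Z W \<longleftrightarrow> (0 \<in> W \<longrightarrow> (\<exists>B\<in>\<B>. Suc ` B \<subseteq> W))" for W
    unfolding Z_def by (simp add: topology_inverse')
  then have "openin Z UNIV"
    using \<open>\<B> \<noteq> {}\<close> by auto
  then have top: "topspace Z = UNIV"
    using openin_subset by blast
  have "\<not> openin Z {0}"
    unfolding Z using \<open>{} \<notin> \<B>\<close> by (auto simp: image_subset_iff)
  then have unique: "\<exists>!x. x \<in> topspace Z \<and> \<not> openin Z {x}"
    by (intro ex1I[of _ 0]) (auto simp: top Z)
  have "character_at Z x \<le>o omega1" for x
  proof (cases "x = 0")
    case True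
    have "local_base Z x ((\<lambda>B. insert 0 (Suc ` B)) ` \<B>)"
      unfolding local_base_def using Z True by auto
    then have "character_at Z x \<le>o |(\<lambda>B. insert 0 (Suc ` B)) ` \<B>|"
      by (rule character_at_ordLeq)
    then show ?thesis
      by (rule ordLeq_transitive[OF _ ordLeq_transitive[OF card_of_image card]])
  next
    case False
    then have "local_base Z x {{x}}"
      unfolding local_base_def using Z by auto
    then show ?thesis
      by (rule ordLeq_transitive[OF character_at_ordLeq countable_ordLeq_omega1]) simp
  qed
  then have "Frechet_Urysohn Z"
    by (intro Frechet_Urysohn_if_small_character[OF p _ unique] character_ordLeq Card_order_omega1)
  moreover have "0 \<in> Z closure_of (range Suc)"
    unfolding in_closure_of
  proof (intro conjI allI impI)
    fix W assume "0 \<in> W \<and> openin Z W"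
    then obtain B where "B \<in> \<B>" "Suc ` B \<subseteq> W"
      by (auto simp: Z)
    moreover obtain b where "b \<in> B"
      using \<open>B \<in> \<B>\<close> \<open>{} \<notin> \<B>\<close> by (metis ex_in_conv)
    ultimately show "\<exists>y. y \<in> range Suc \<and> y \<in> W" by blast
  qed (simp add: top)
  ultimately obtain t where t: "range t \<subseteq> range Suc" "limitin Z t 0 sequentially"
    unfolding Frechet_Urysohn_def top by blast
  define s where "s n = t n - 1" for n
  have s: "t n = Suc (s n)" for n
  proof -
    have "t n \<in> range Suc" using t(1) by blast
    then show ?thesis by (auto simp: s_def)
  qed
  have "\<forall>\<^sub>F n in sequentially. s n \<in> B" if "B \<in> \<B>" for B
  proof -
    have "openin Z (insert 0 (Suc ` B))"
      unfolding Z using that by blast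
    then have "\<forall>\<^sub>F n in sequentially. t n \<in> insert 0 (Suc ` B)"
      using t(2) unfolding limitin_def by blast
    then show ?thesis
      by eventually_elim (auto simp: s)
  qed
  then show ?thesis using that by blast
qed

context independent_family
begin

text \<open>The traces of the basic neighbourhoods of \<open>x\<close> on the sets \<open>A k\<close> form a filter base of size at
  most \<open>\<omega>\<^sub>1\<close>. Letting \<open>A\<close> vary with \<open>k\<close> makes the space strongly Frechet; this is stronger
  than the Frechet-Urysohn property, and the argument against cs-networks needs it.\<close>

lemma sequence_through_closures:
  assumes p: "omega1 <o cardinal_p" and card: "|I| =o omega1"
    and dec: "decseq A" and cl: "\<And>k :: nat. x \<in> X closure_of A k"
  obtains s where "limitin X s x sequentially" "\<And>k. \<forall>\<^sub>F n in sequentially. s n \<in> A k"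
proof -
  define \<B> where "\<B> = (\<lambda>(F, k). cell U F x \<inter> A k) ` (Fpow I \<times> UNIV)"
  have mem: "cell U F x \<inter> A k \<in> \<B>" if "finite F" "F \<subseteq> I" for F k
    unfolding \<B>_def using that by (auto simp: Fpow_def)
  have "|\<B>| \<le>o omega1"
    unfolding \<B>_def
    by (intro ordLeq_transitive[OF card_of_image] card_of_Fpow_Times_ordLeq_omega1 card) simp
  moreover have "\<B> \<noteq> {}"
    using mem[of "{}"] by blast
  moreover have "cell U F x \<inter> A k \<noteq> {}" if "finite F" "F \<subseteq> I" for F k
    using cl[of k] openin_cell[OF that, of U x] cell_self[of x U F] unfolding in_closure_of
    by (metis IntI empty_iff)
  then have "{} \<notin> \<B>"
    unfolding \<B>_def Fpow_def by force
  moreover have "\<exists>C\<in>\<B>. C \<subseteq> B \<inter> B'" if BB: "B \<in> \<B>" "B' \<in> \<B>" for B B'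
  proof -
    obtain F k F' k' where *: "finite F" "F \<subseteq> I" "B = cell U F x \<inter> A k"
      "finite F'" "F' \<subseteq> I" "B' = cell U F' x \<inter> A k'"
      using BB unfolding \<B>_def Fpow_def by auto
    have "A (max k k') \<subseteq> A k \<inter> A k'"
      using dec by (auto simp: decseq_def dest: monotoneD)
    then show ?thesis
      using * mem[of "F \<union> F'" "max k k'"] by (intro bexI) (auto simp: cell_Un)
  qed
  ultimately obtain s where s: "\<And>B. B \<in> \<B> \<Longrightarrow> \<forall>\<^sub>F n in sequentially. s n \<in> B"
    using sequence_along_filter_base[OF p] by metis
  have "\<forall>\<^sub>F n in sequentially. s n \<in> U i \<longleftrightarrow> x \<in> U i" if "i \<in> I" for i
  proof -
    have "\<forall>\<^sub>F n in sequentially. s n \<in> cell U {i} x \<inter> A 0"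
      using that by (intro s mem) auto
    then show ?thesis
      by eventually_elim (auto simp: cell_def)
  qed
  moreover have "\<forall>\<^sub>F n in sequentially. s n \<in> A k" for k
    using s[OF mem[of "{}" k]] by (auto elim: eventually_mono)
  ultimately show ?thesis
    using that[of s] by (simp add: limitin_cell_topology)
qed

lemma Frechet_Urysohn:
  assumes "omega1 <o cardinal_p" "|I| =o omega1"
  shows "Frechet_Urysohn X"
  unfolding Frechet_Urysohn_def
proof (intro allI impI)
  fix A x assume Ax: "A \<subseteq> topspace X \<and> x \<in> X closure_of A"
  then have x: "\<And>k :: nat. x \<in> X closure_of A" by blast
  have dec: "decseq (\<lambda>_ :: nat. A)" by (simp add: decseq_def)
  obtain s where s: "limitin X s x sequentially" "\<forall>\<^sub>F n in sequentially. s n \<in> A"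
    using sequence_through_closures[OF assms dec x] by blast
  obtain a where a: "a \<in> A"
    using Ax by (metis closure_of_empty empty_iff equals0I)
  have "\<forall>\<^sub>F n in sequentially. s n = (if s n \<in> A then s n else a)"
    using s(2) by eventually_elim simp
  then have "limitin X (\<lambda>n. if s n \<in> A then s n else a) x sequentially"
    by (rule limitin_transform_eventually[OF _ s(1)])
  then show "\<exists>s. range s \<subseteq> A \<and> limitin X s x sequentially"
    using a by (intro exI[of _ "\<lambda>n. if s n \<in> A then s n else a"]) auto
qed

text \<open>Choose \<open>J\<close> so that the closures of all network members are closed over \<open>J\<close>, and \<open>i\<close> outside
  \<open>J\<close>. Finite unions of closures of members inside \<open>U i\<close> are then nowhere dense, so a sequence in \<open>U i\<close>
  can converge to a point of \<open>U i\<close> while leaving each of these finite unions. Such a sequence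
  meets no network member inside \<open>U i\<close> infinitely often.\<close>

lemma not_cs_cosmic:
  assumes "omega1 <o cardinal_p" "|I| =o omega1"
  shows "\<not> cs_cosmic X"
proof
  assume "cs_cosmic X"
  then obtain \<N> where \<N>: "countable \<N>" "cs_network X \<N>"
    unfolding cs_cosmic_def by blast
  have "countable ((\<lambda>N. - (X closure_of N)) ` \<N>)"
    using \<N>(1) by simp
  then obtain J i where J: "J \<subseteq> I" "i \<in> I" "i \<notin> J"
    and op: "\<And>V. V \<in> (\<lambda>N. - (X closure_of N)) ` \<N> \<Longrightarrow> openin (cell_topology U J) V"
    by (rule reflection) (use closedin_closure_of[of X] in \<open>auto simp: closedin_def Compl_eq_Diff_UNIV\<close>)
  \<comment> \<open>The empty set makes \<open>\<M>\<close> nonempty, so that it is the range of a sequence.\<close>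
  define \<M> where "\<M> = insert {} {N \<in> \<N>. N \<subseteq> U i}"
  have \<M>: "countable \<M>" "\<M> \<noteq> {}"
    using \<N>(1) by (auto simp: \<M>_def)
  define e where "e = from_nat_into \<M>"
  have e: "range e = \<M>"
    unfolding e_def using \<M> by (simp add: range_from_nat_into)
  have closed_e: "closedin (cell_topology U J) (X closure_of e k)" for k
  proof -
    have "e k = {} \<or> e k \<in> \<N>"
      using e unfolding \<M>_def by blast
    then show ?thesis
    proof
      assume "e k \<in> \<N>"
      then have "openin (cell_topology U J) (- (X closure_of e k))"
        by (intro op imageI)
      then show ?thesis
        by (simp add: closedin_def Compl_eq_Diff_UNIV)
    qed simp
  qed
  have sub_e: "X closure_of e k \<subseteq> U i" for k
  proof -
    have "e k \<subseteq> U i"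
      using e unfolding \<M>_def by blast
    then show ?thesis
      using closedin_member[of i I U] J by (simp add: closure_of_minimal)
  qed
  define D where "D k = (\<Union>j\<le>k. X closure_of e j)" for k
  have D: "closedin (cell_topology U J) (D k)" "D k \<subseteq> U i" for k
    unfolding D_def using closed_e sub_e by (auto intro!: closedin_Union)
  obtain x where x: "x \<in> U i"
    using member_cell_meet(1)[of "{}" i] J by blast
  have "x \<in> X closure_of (U i - D k)" for k
    unfolding in_closure_of
  proof (intro conjI allI impI)
    fix W assume W: "x \<in> W \<and> openin X W"
    then have "openin X (W \<inter> U i)" "x \<in> W \<inter> U i"
      using x J openin_member[of i I U] by auto
    then have "\<not> W \<inter> U i \<subseteq> D k"
      using closedin_subset_member_nowhere_dense[OF J D(1) D(2)] by blast
    then show "\<exists>y. y \<in> U i - D k \<and> y \<in> W" by blast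
  qed simp
  moreover have "decseq (\<lambda>k. U i - D k)"
    unfolding decseq_def D_def by force
  ultimately obtain s where s: "limitin X s x sequentially"
    "\<And>k. \<forall>\<^sub>F n in sequentially. s n \<in> U i - D k"
    using sequence_through_closures[OF assms] by metis
  then obtain N where N: "N \<in> \<N>" "N \<subseteq> U i" "infinite {n. s n \<in> N}"
    using \<N>(2) x openin_member[of i I U] J unfolding cs_network_def by fastforce
  then have "N \<in> range e"
    by (simp add: e \<M>_def)
  then obtain k where "e k = N" by blast
  then have "N \<subseteq> D k"
    using closure_of_subset[of N X] unfolding D_def by auto
  then have "\<forall>\<^sub>F n in sequentially. s n \<notin> N"
    using s(2)[of k] by (auto elim: eventually_mono)
  then show False
    using N(3) by (simp add: eventually_cofinite flip: cofinite_eq_sequentially)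
qed

end

section \<open>Consequences of the continuum hypothesis\<close>

context independent_family
begin

context
  assumes splits: "infinite A \<Longrightarrow> \<exists>i\<in>I. infinite (A \<inter> U i) \<and> infinite (A - U i)"
begin

text \<open>If the sequence had infinitely many values, some \<open>U i\<close> would split its range into two infinite parts,
  but almost all terms lie on the same side of \<open>U i\<close> as the limit.\<close>

lemma finite_range_if_convergent:
  assumes "limitin X s x sequentially"
  shows "finite (range s)"
proof (rule ccontr)
  assume "infinite (range s)"
  then obtain i where i: "i \<in> I" "infinite (range s \<inter> U i)" "infinite (range s - U i)"
    using splits by blast
  then have "\<forall>\<^sub>F n in sequentially. s n \<in> U i \<longleftrightarrow> x \<in> U i"
    using assms unfolding limitin_cell_topology by blast
  then obtain N where N: "\<And>n. n \<ge> N \<Longrightarrow> s n \<in> U i \<longleftrightarrow> x \<in> U i"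
    unfolding eventually_sequentially by blast
  show False
  proof (cases "x \<in> U i")
    case True
    then have "range s - U i \<subseteq> s ` {..<N}"
      using N by (force simp: not_le)
    then show False
      using i(3) finite_subset by blast
  next
    case False
    then have "range s \<inter> U i \<subseteq> s ` {..<N}"
      using N by (force simp: not_le)
    then show False
      using i(2) finite_subset by blast
  qed
qed

text \<open>A convergent sequence has finite range, so one of its values is taken infinitely often, and this
  value is the limit.\<close>

lemma cs_cosmic: "cs_cosmic X"
proof -
  have "cs_network X (range (\<lambda>x. {x}))"
    unfolding cs_network_def
  proof (intro conjI allI impI)
    fix W s x
    assume *: "openin X W \<and> range s \<subseteq> topspace X \<and> limitin X s x sequentially \<and> x \<in> W"
    then obtain m where "infinite {n. s n = s m}"
      using pigeonhole_infinite[of "UNIV :: nat set" s] finite_range_if_convergent by auto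
    then have "infinite {n. s n \<in> {x}}"
      using limit_of_constant_subsequence[of s x "s m"] * by simp
    then show "\<exists>N\<in>range (\<lambda>x. {x}). N \<subseteq> W \<and> infinite {n. s n \<in> N}"
      using * by blast
  qed simp
  then show ?thesis
    unfolding cs_cosmic_def using regular_Hausdorff
    by (intro conjI exI[of _ "range (\<lambda>x. {x})"]) auto
qed

text \<open>Let \<open>x\<close> be an accumulation point of \<open>K\<close>. Countably many clopen neighbourhoods of \<open>x\<close>
  intersect in \<open>{x}\<close>; by compactness their finite intersections form a neighbourhood base
  of \<open>x\<close> relative to \<open>K\<close>. A sequence in \<open>K - {x}\<close> that runs through them converges to \<open>x\<close> and has
  infinite range.\<close>

lemma compact_imp_finite:
  assumes K: "compactin X K"
  shows "finite K"
proof (rule ccontr)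
  assume "infinite K"
  then obtain x where x: "x \<in> K" "x \<in> X derived_set_of K"
    using compactin_imp_Bolzano_Weierstrass[OF K, of K] by blast
  obtain i where i: "\<And>y. y \<noteq> x \<Longrightarrow> i y \<in> I \<and> \<not> (x \<in> U (i y) \<longleftrightarrow> y \<in> U (i y))"
    using separating by metis
  define F where "F n = i ` ({..<n} - {x})" for n
  have F: "finite (F n)" "F n \<subseteq> I" for n
    unfolding F_def using i by auto
  have "\<exists>y. y \<noteq> x \<and> y \<in> K \<and> y \<in> cell U (F n) x" for n
    using x(2) openin_cell[OF F, of U n x] cell_self[of x U "F n"]
    unfolding in_derived_set_of by blast
  then obtain s where s: "\<And>n. s n \<noteq> x \<and> s n \<in> K \<and> s n \<in> cell U (F n) x"
    by metis
  \<comment> \<open>The cell over \<open>F n\<close> around \<open>x\<close> omits every point below \<open>n\<close> other than \<open>x\<close>.\<close>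
  have ge: "n \<le> s n" for n
  proof (rule ccontr)
    assume "\<not> n \<le> s n"
    then have "i (s n) \<in> F n"
      unfolding F_def using s[of n] by auto
    then have "s n \<in> U (i (s n)) \<longleftrightarrow> x \<in> U (i (s n))"
      using s[of n] by (simp add: cell_def)
    then show False
      using i[of "s n"] s[of n] by blast
  qed
  have "\<forall>\<^sub>F n in sequentially. s n \<in> U j \<longleftrightarrow> x \<in> U j" if j: "j \<in> I" for j
  proof -
    \<comment> \<open>A finite subcover of \<open>K\<close> shows that a late cell around \<open>x\<close> meets \<open>K\<close> within \<open>cell U {j} x\<close>.\<close>
    define \<C> where "\<C> = insert (cell U {j} x) (range (\<lambda>n. - cell U (F n) x))"
    have "openin X (- cell U (F n) x)" for n
      using closedin_cell[OF F, of U n x] by (simp add: closedin_def Compl_eq_Diff_UNIV)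
    then have "\<And>C. C \<in> \<C> \<Longrightarrow> openin X C"
      unfolding \<C>_def using openin_cell[of "{j}" I U x] j by auto
    moreover have "y \<in> \<Union>\<C>" for y
    proof (cases "y = x")
      case True
      then show ?thesis unfolding \<C>_def by auto
    next
      case False
      then have "i y \<in> F (Suc y)"
        unfolding F_def by auto
      then have "y \<notin> cell U (F (Suc y)) x"
        using i[OF False] by (auto simp: cell_def)
      then show ?thesis unfolding \<C>_def by blast
    qed
    ultimately have "\<exists>\<D>. finite \<D> \<and> \<D> \<subseteq> \<C> \<and> K \<subseteq> \<Union>\<D>"
      by (intro compactinD[OF K] subsetI) simp_all
    then obtain \<D> where \<D>: "finite \<D>" "\<D> \<subseteq> \<C>" "K \<subseteq> \<Union>\<D>" by blast
    have "finite (\<D> - {cell U {j} x})" "\<D> - {cell U {j} x} \<subseteq> (\<lambda>n. - cell U (F n) x) ` UNIV"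
      using \<D> unfolding \<C>_def by auto
    then obtain M where M: "finite M" "\<D> - {cell U {j} x} = (\<lambda>n. - cell U (F n) x) ` M"
      using finite_subset_image by metis
    have "s n \<in> cell U {j} x" if n: "n \<ge> Max (insert 0 M)" for n
    proof (rule ccontr)
      assume "s n \<notin> cell U {j} x"
      moreover obtain D where "D \<in> \<D>" "s n \<in> D"
        using s[of n] \<D>(3) by blast
      ultimately have "D \<in> \<D> - {cell U {j} x}" by blast
      then obtain m where m: "m \<in> M" "D = - cell U (F m) x"
        using M(2) by auto
      then have "m \<le> n"
        using n M(1) by simp
      then have "F m \<subseteq> F n"
        unfolding F_def by auto
      then have "s n \<in> cell U (F m) x"
        using s[of n] unfolding cell_def by blast
      then show False
        using \<open>s n \<in> D\<close> m by blast
    qed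
    then show ?thesis
      unfolding eventually_sequentially cell_def by auto
  qed
  then have "finite (range s)"
    using finite_range_if_convergent[of s x] by (simp add: limitin_cell_topology)
  then obtain b where "\<And>n. s n \<le> b"
    by (meson Max_ge rangeI)
  then show False
    using ge[of "Suc b"] by (metis not_less_eq_eq order_trans)
qed

end

end

section \<open>Construction of the family\<close>

text \<open>Choose numbers \<open>c 0 < c 1 < \<dots>\<close> in such a way that every member of \<open>\<C>\<close> is served infinitely often, each
  time by two consecutive terms; \<open>S\<close> consists of the terms with even index.\<close>

lemma splitting_set:
  fixes \<C> :: "nat set set"
  assumes "countable \<C>" and inf: "\<And>C. C \<in> \<C> \<Longrightarrow> infinite C"
  obtains S where "\<And>C. C \<in> \<C> \<Longrightarrow> infinite (C \<inter> S) \<and> infinite (C - S)"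
proof (cases "\<C> = {}")
  case True
  then show ?thesis using that by blast
next
  case False
  \<comment> \<open>The pairing function lets every member of \<open>\<C>\<close> occur infinitely often in \<open>e\<close>; division by \<open>2\<close>
    repeats each occurrence.\<close>
  define e where "e n = from_nat_into \<C> (fst (prod_decode (n div 2)))" for n
  have e: "infinite (e n)" for n
    unfolding e_def using inf False by (simp add: from_nat_into)
  have ex: "\<exists>y. y \<in> e n \<and> b < y" for n b
    using e[of n] by (meson infinite_nat_iff_unbounded)
  have "\<exists>c. \<forall>n. c n \<in> e n \<and> c n < c (Suc n)"
    by (rule dependent_nat_choice) (use ex in blast)+
  then obtain c where c: "\<And>n. c n \<in> e n" "\<And>n. c n < c (Suc n)"
    by blast
  have inj: "c m = c n \<longleftrightarrow> m = n" for m n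
    using c(2) strict_mono_Suc_iff strict_mono_eq by blast
  define S where "S = c ` {n. even n}"
  have "infinite (C \<inter> S) \<and> infinite (C - S)" if "C \<in> \<C>" for C
  proof -
    obtain k where k: "from_nat_into \<C> k = C"
      using from_nat_into_surj[OF assms(1) \<open>C \<in> \<C>\<close>] by blast
    have "range (\<lambda>m. c (2 * prod_encode (k, m))) \<subseteq> C \<inter> S"
      using c(1)[of "2 * prod_encode (k, m)" for m] by (auto simp: S_def e_def k)
    moreover have "infinite (range (\<lambda>m. c (2 * prod_encode (k, m))))"
      by (intro range_inj_infinite injI) (simp add: inj prod_encode_eq)
    moreover have "range (\<lambda>m. c (Suc (2 * prod_encode (k, m)))) \<subseteq> C - S"
      using c(1)[of "Suc (2 * prod_encode (k, m))" for m] by (auto simp: S_def e_def k inj)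
    moreover have "infinite (range (\<lambda>m. c (Suc (2 * prod_encode (k, m)))))"
      by (intro range_inj_infinite injI) (simp add: inj prod_encode_eq)
    ultimately show ?thesis
      using infinite_super by blast
  qed
  then show ?thesis using that by blast
qed

text \<open>Changing a splitting set at two points makes it separate them and leaves it splitting.\<close>

lemma splitting_separating_set:
  fixes \<C> :: "nat set set"
  assumes "countable \<C>" and "\<And>C. C \<in> \<C> \<Longrightarrow> infinite C"
  shows "\<exists>S. (\<forall>C\<in>\<C>. infinite (C \<inter> S) \<and> infinite (C - S)) \<and>
    (\<forall>x y. A = {x, y} \<and> x \<noteq> y \<longrightarrow> \<not> (x \<in> S \<longleftrightarrow> y \<in> S))"
proof -
  obtain S where S: "\<And>C. C \<in> \<C> \<Longrightarrow> infinite (C \<inter> S) \<and> infinite (C - S)"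
    using splitting_set assms by metis
  show ?thesis
  proof (cases "\<exists>x y. A = {x, y} \<and> x \<noteq> y")
    case False
    then show ?thesis using S by blast
  next
    case True
    then obtain x y where A: "A = {x, y}" "x \<noteq> y" by blast
    have "infinite (C \<inter> insert x (S - {y})) \<and> infinite (C - insert x (S - {y}))" if "C \<in> \<C>" for C
    proof
      have "infinite (C \<inter> S - {y})" "infinite (C - S - {x})"
        using S[OF that] by simp_all
      moreover have "C \<inter> S - {y} \<subseteq> C \<inter> insert x (S - {y})"
        "C - S - {x} \<subseteq> C - insert x (S - {y})" by blast+
      ultimately show "infinite (C \<inter> insert x (S - {y}))" "infinite (C - insert x (S - {y}))"
        using infinite_super by blast+
    qed
    moreover have "\<not> (u \<in> insert x (S - {y}) \<longleftrightarrow> v \<in> insert x (S - {y}))" if "A = {u, v}" for u v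
      using that A by (auto simp: doubleton_eq_iff)
    ultimately show ?thesis by blast
  qed
qed

lemma finite_has_Well_order_max:
  assumes "Well_order r" "finite F" "F \<noteq> {}" "F \<subseteq> Field r"
  shows "\<exists>m\<in>F. F - {m} \<subseteq> underS r m"
proof -
  have "\<exists>m\<in>F. \<forall>j\<in>F. (j, m) \<in> r"
    using assms(2-4)
  proof (induction F rule: finite_ne_induct)
    case (singleton a)
    then show ?case
      using assms(1) by (auto simp: order_on_defs refl_on_def)
  next
    case (insert a F)
    then obtain m where m: "m \<in> F" "\<forall>j\<in>F. (j, m) \<in> r" by auto
    have tr: "trans r" "(a, a) \<in> r"
      using assms(1) insert.prems by (auto simp: order_on_defs refl_on_def)
    have "(a, m) \<in> r \<or> (m, a) \<in> r"
      using assms(1) insert m by (auto simp: order_on_defs total_on_def refl_on_def)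
    then show ?case
    proof
      assume "(a, m) \<in> r"
      then show ?case using m by blast
    next
      assume "(m, a) \<in> r"
      then have "\<forall>j\<in>insert a F. (j, a) \<in> r"
        using m(2) tr by (auto dest: transD)
      then show ?case by blast
    qed
  qed
  then show ?thesis
    unfolding underS_def by blast
qed

text \<open>Recursion along \<open>r\<close>: the set \<open>U i\<close> splits the countably many infinite atoms of the earlier sets,
  and also \<open>p i\<close> if that is infinite, and it separates the points of \<open>p i\<close> if there are exactly two.
  An atom over a finite set \<open>F\<close> is one half of an atom over \<open>F\<close> without its largest index, which is
  infinite by induction. So independence holds in the stronger form that all atoms are infinite.\<close>

lemma independent_splitting_family:
  fixes p :: "'i \<Rightarrow> nat set"
  assumes wo: "Well_order r" and ctbl: "\<And>i. countable (underS r i)"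
  obtains U :: "'i \<Rightarrow> nat set"
  where "\<And>F P. finite F \<Longrightarrow> F \<subseteq> Field r \<Longrightarrow> infinite (atom U F P)"
    and "\<And>i. infinite (p i) \<Longrightarrow> infinite (p i \<inter> U i) \<and> infinite (p i - U i)"
    and "\<And>i x y. p i = {x, y} \<Longrightarrow> x \<noteq> y \<Longrightarrow> \<not> (x \<in> U i \<longleftrightarrow> y \<in> U i)"
proof -
  define \<C> where "\<C> f i = {C \<in> insert (p i) {atom f F P | F P. finite F \<and> F \<subseteq> underS r i}. infinite C}"
    for f :: "'i \<Rightarrow> nat set" and i
  define Q where "Q f i S \<longleftrightarrow> (\<forall>C\<in>\<C> f i. infinite (C \<inter> S) \<and> infinite (C - S)) \<and>
      (\<forall>x y. p i = {x, y} \<and> x \<noteq> y \<longrightarrow> \<not> (x \<in> S \<longleftrightarrow> y \<in> S))" for f i S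
  have countable_\<C>: "countable (\<C> f i)" for f i
  proof -
    have "{atom f F P | F P. finite F \<and> F \<subseteq> underS r i} \<subseteq>
        (\<lambda>(F, P). atom f F P) ` (Fpow (underS r i) \<times> Fpow (underS r i))"
    proof clarify
      fix F P assume F: "finite F" "F \<subseteq> underS r i"
      have "atom f F P = atom f F (P \<inter> F)"
        by (auto simp: atom_def)
      moreover have "(F, P \<inter> F) \<in> Fpow (underS r i) \<times> Fpow (underS r i)"
        using F by (auto simp: Fpow_def)
      ultimately show "atom f F P \<in> (\<lambda>(F, P). atom f F P) ` (Fpow (underS r i) \<times> Fpow (underS r i))"
        by (intro image_eqI[of _ _ "(F, P \<inter> F)"]) simp_all
    qed
    moreover have "countable (Fpow (underS r i) \<times> Fpow (underS r i))"
      using ctbl countable_Fpow by blast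
    ultimately have "countable {atom f F P | F P. finite F \<and> F \<subseteq> underS r i}"
      by (rule countable_subset[OF _ countable_image])
    then show ?thesis
      unfolding \<C>_def by (intro countable_Collect) simp
  qed
  have "\<exists>U. \<forall>i. Q U i (U i)"
  proof (rule dependent_wf_choice)
    show "wf (r - Id)"
      using wo by (simp add: well_order_on_def)
  next
    fix f g :: "'i \<Rightarrow> nat set" and i S
    assume "\<And>j. (j, i) \<in> r - Id \<Longrightarrow> f j = g j"
    then have "atom f F P = atom g F P" if "F \<subseteq> underS r i" for F P
      using that by (auto simp: atom_def underS_def subset_iff)
    then have "(\<exists>F P. C = atom f F P \<and> finite F \<and> F \<subseteq> underS r i) \<longleftrightarrow>
        (\<exists>F P. C = atom g F P \<and> finite F \<and> F \<subseteq> underS r i)" for C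
      by metis
    then have "\<C> f i = \<C> g i"
      by (simp add: \<C>_def)
    then show "Q f i S = Q g i S"
      unfolding Q_def by simp
  next
    fix i and f :: "'i \<Rightarrow> nat set"
    show "\<exists>S. Q f i S"
      unfolding Q_def using countable_\<C> by (rule splitting_separating_set) (simp add: \<C>_def)
  qed
  then obtain U where U: "\<And>i. Q U i (U i)" by blast
  have split: "infinite (C \<inter> U i) \<and> infinite (C - U i)" if "C \<in> \<C> U i" for C i
    using U that unfolding Q_def by blast
  have "infinite (atom U F P)" if "finite F" "F \<subseteq> Field r" for F P
    using that
  proof (induction "card F" arbitrary: F)
    case 0
    then show ?case by (simp add: atom_def)
  next
    case (Suc n)
    then have "F \<noteq> {}" by auto
    then obtain m where m: "m \<in> F" "F - {m} \<subseteq> underS r m"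
      using finite_has_Well_order_max[OF wo Suc.prems(1) _ Suc.prems(2)] by blast
    have "infinite (atom U (F - {m}) P)"
      using Suc m by (intro Suc.hyps(1)) auto
    then have "atom U (F - {m}) P \<in> \<C> U m"
      unfolding \<C>_def using m Suc.prems by auto
    moreover have "atom U F P = (if m \<in> P then atom U (F - {m}) P \<inter> U m else atom U (F - {m}) P - U m)"
      using m by (auto simp: atom_def)
    ultimately show ?case
      using split by simp
  qed
  moreover have "infinite (p i \<inter> U i) \<and> infinite (p i - U i)" if "infinite (p i)" for i
    using that by (intro split) (simp add: \<C>_def)
  moreover have "\<not> (x \<in> U i \<longleftrightarrow> y \<in> U i)" if "p i = {x, y}" "x \<noteq> y" for i x y
    using U[of i] that unfolding Q_def by blast
  ultimately show ?thesis
    by (rule that)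
qed

text \<open>The requirements \<open>p i\<close> of the construction. The two-element sets must always occur, in order to
  make the space Hausdorff; the infinite sets can all be listed only if \<open>\<omega>\<^sub>1 = \<cc>\<close>. The indices are
  sets of natural numbers just because \<open>\<omega>\<^sub>1\<close> is realised as a well-order on that type.\<close>

lemma omega1_enumeration:
  obtains p :: "nat set \<Rightarrow> nat set"
  where "\<And>A. finite A \<Longrightarrow> \<exists>i\<in>Field omega1. p i = A"
    and "\<And>A. omega1 =o continuum \<Longrightarrow> \<exists>i\<in>Field omega1. p i = A"
proof (cases "omega1 =o continuum")
  case True
  have "|UNIV :: nat set set| =o continuum"
    unfolding continuum_def using nat_sets_eqpoll_reals eqpoll_iff_card_of_ordIso by blast
  then have "|UNIV :: nat set set| =o |Field omega1|"
    using True Field_omega1(1) by (meson ordIso_symmetric ordIso_transitive)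
  then have "|UNIV :: nat set set| \<le>o |Field omega1|"
    using ordIso_iff_ordLeq by blast
  then obtain p :: "nat set \<Rightarrow> nat set" where "p ` Field omega1 = UNIV"
    using card_of_ordLeq2[of "UNIV :: nat set set" "Field omega1"] by blast
  then show ?thesis
    using that[of p] by (metis UNIV_I imageE)
next
  case False
  have "|Fpow (UNIV :: nat set)| \<le>o omega1"
    by (intro countable_ordLeq_omega1 countable_Fpow) simp
  then have "|Fpow (UNIV :: nat set)| \<le>o |Field omega1|"
    using Field_omega1(1) by (meson ordIso_symmetric ordLeq_ordIso_trans)
  then obtain p :: "nat set \<Rightarrow> nat set" where p: "p ` Field omega1 = Fpow UNIV"
    using card_of_ordLeq2[of "Fpow (UNIV :: nat set)" "Field omega1"] by (auto simp: Fpow_def)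
  have "\<exists>i\<in>Field omega1. p i = A" if "finite A" for A
  proof -
    have "A \<in> p ` Field omega1"
      using that by (simp add: p Fpow_def)
    then show ?thesis by blast
  qed
  then show ?thesis
    using that[of p] False by blast
qed

theorem mainTheorem4:
  shows "\<exists>X :: nat topology.
     regular_Hausdorff X \<and> countable (topspace X) \<and> weight X =o omega1 \<and>
     (\<not> cometrizable X \<and> \<not> stratifiable X) \<and>
     (omega1 =o continuum \<longrightarrow>
        (\<nexists>K. compactin X K \<and> infinite K) \<and> cs_cosmic X) \<and>
     (omega1 <o cardinal_p \<longrightarrow>
        Frechet_Urysohn X \<and> \<not> cs_cosmic X)"
proof -
  obtain p :: "nat set \<Rightarrow> nat set"
    where fin: "\<And>A. finite A \<Longrightarrow> \<exists>i\<in>Field omega1. p i = A"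
      and CH: "\<And>A. omega1 =o continuum \<Longrightarrow> \<exists>i\<in>Field omega1. p i = A"
    using omega1_enumeration by metis
  have "Well_order omega1"
    using Card_order_omega1 by (simp add: card_order_on_well_order_on)
  then obtain U :: "nat set \<Rightarrow> nat set"
    where inf_atom: "\<And>F P. finite F \<Longrightarrow> F \<subseteq> Field omega1 \<Longrightarrow> infinite (atom U F P)"
      and split: "\<And>i. infinite (p i) \<Longrightarrow> infinite (p i \<inter> U i) \<and> infinite (p i - U i)"
      and sep: "\<And>i x y. p i = {x, y} \<Longrightarrow> x \<noteq> y \<Longrightarrow> \<not> (x \<in> U i \<longleftrightarrow> y \<in> U i)"
    using independent_splitting_family[of omega1 p, OF _ countable_underS_omega1] by metis
  interpret independent_family "Field omega1" U
  proof
    show "atom U F P \<noteq> {}" if "finite F" "F \<subseteq> Field omega1" for F P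
      using inf_atom[OF that, of P] by auto
    show "\<exists>i\<in>Field omega1. \<not> (x \<in> U i \<longleftrightarrow> y \<in> U i)" if "x \<noteq> y" for x y
      using fin[of "{x, y}"] sep that by blast
    show "uncountable (Field omega1)" by (rule Field_omega1)
  qed
  have splits: "\<exists>i\<in>Field omega1. infinite (A \<inter> U i) \<and> infinite (A - U i)"
    if "omega1 =o continuum" "infinite A" for A
    using CH[OF that(1), of A] split that(2) by blast
  show ?thesis
  proof (intro exI[of _ X] conjI impI)
    show "\<nexists>K. compactin X K \<and> infinite K" if "omega1 =o continuum"
      using compact_imp_finite splits[OF that] by blast
    show "cs_cosmic X" if "omega1 =o continuum"
      using cs_cosmic splits[OF that] by blast
  qed (simp_all add: regular_Hausdorff weight_X Field_omega1 not_cometrizable not_stratifiable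
        Frechet_Urysohn not_cs_cosmic)
qed

end
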